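(* Let $n$ be a positive integer and let $D_n$ be a maximal Diophantine graph of order $n$ with Diophantine labelling $f$. Let $u,v\in V(D_n)$ with $\deg(u)<n-1$ and $\deg(v)<n-1$, and suppose $f(u)=p^t$ and $f(v)=q^k$ for some prime numbers $p,q$ and some positive integers $t,k$. Then $$\deg(u)=\deg(v)\quad\text{if and only if}\quad \acute{v}_p(n)\leq t,\ \acute{v}_q(n)\leq k\ \text{ and }\ \left\lfloor\frac{n}{p^{\acute{v}_p(n)}}\right\rfloor =\left\lfloor\frac{n}{q^{\acute{v}_q(n)}}\right\rfloor.$$
   Context: All graphs are finite, simple and undirected, and $(a,b)$ denotes the greatest common divisor of $a$ and $b$. A graph $G=(V,E)$ of order $n$ is a Diophantine graph if there is a bijection $f:V\to\{1,2,\dots,n\}$ (a Diophantine labelling) such that $(f(u),f(v))\mid n$ for all $uv\in E$. It is a maximal Diophantine graph, denoted $(D_n,f)$ or simply $D_n$, if adding any new edge turns it into a non-Diophantine graph; thus two distinct vertices $u,v$ of $D_n$ are adjacent if and only if $(f(u),f(v))\mid n$. For a prime $p$, $v_p(n)$ is the $p$-adic valuation of $n$, and $\acute{v}_p(n):=v_p(n)+1$. *)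

theory Defs
  imports Complex_Main "HOL-Computational_Algebra.Primes" "HOL-Library.Ramsey"
begin

text \<open>A finite simple undirected graph is a pair of a vertex set \<open>V\<close> and a set \<open>E\<close> of
  unordered pairs of distinct vertices; \<open>[V]\<^bsup>2\<^esup>\<close> is the set of all two-element subsets of \<open>V\<close>.\<close>

definition simple_graph :: "'a set \<Rightarrow> 'a set set \<Rightarrow> bool" where
  "simple_graph V E \<longleftrightarrow> finite V \<and> E \<subseteq> [V]\<^bsup>2\<^esup>"

definition vertex_degree :: "'a set \<Rightarrow> 'a set set \<Rightarrow> 'a \<Rightarrow> nat" where
  "vertex_degree V E v = card {w \<in> V. {v, w} \<in> E}"

definition diophantine_labelling :: "'a set \<Rightarrow> 'a set set \<Rightarrow> ('a \<Rightarrow> nat) \<Rightarrow> bool" where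
  "diophantine_labelling V E f \<longleftrightarrow>
     bij_betw f V {1..card V} \<and> (\<forall>u v. {u, v} \<in> E \<longrightarrow> gcd (f u) (f v) dvd card V)"

definition diophantine_graph :: "'a set \<Rightarrow> 'a set set \<Rightarrow> bool" where
  "diophantine_graph V E \<longleftrightarrow> simple_graph V E \<and> (\<exists>f. diophantine_labelling V E f)"

text \<open>Maximality concerns Diophantine graphs, not labellings: after adding an edge, no labelling
  whatsoever is Diophantine. For every Diophantine labelling \<open>f\<close> of such a graph, distinct vertices
  \<open>u\<close>, \<open>v\<close> are then adjacent iff \<open>gcd (f u) (f v)\<close> divides the order.\<close>

definition maximal_diophantine_graph :: "'a set \<Rightarrow> 'a set set \<Rightarrow> bool" where
  "maximal_diophantine_graph V E \<longleftrightarrow>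
     diophantine_graph V E \<and> (\<forall>e \<in> [V]\<^bsup>2\<^esup> - E. \<not> diophantine_graph V (insert e E))"

definition vsucc :: "nat \<Rightarrow> nat \<Rightarrow> nat" where
  "vsucc p n = multiplicity p n + 1"

end

(* A vertex labelled p ^ t fails to be adjacent to a vertex w exactly when p ^ t and f w are both
   divisible by p ^ vsucc p n, the least power of p that does not divide n. If u itself is not
   adjacent to everything, then u is among the n div p ^ vsucc p n vertices whose labels are such
   multiples, so its degree is n - n div p ^ vsucc p n. *)

theory Submission
  imports Defs
begin

text \<open>Maximality excludes every labelling of the enlarged graph, so in particular it excludes
  \<open>f\<close>. If a non-adjacent pair had a gcd dividing the order, \<open>f\<close> would
  remain a Diophantine labelling after that edge is added.\<close>

lemma maximal_diophantine_adjacent_iff: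
  assumes max: "maximal_diophantine_graph V E" and lab: "diophantine_labelling V E f"
    and "u \<in> V" "w \<in> V"
  shows "{u, w} \<in> E \<longleftrightarrow> u \<noteq> w \<and> gcd (f u) (f w) dvd card V"
proof
  assume "{u, w} \<in> E"
  moreover have "E \<subseteq> [V]\<^bsup>2\<^esup>"
    using max by (simp add: maximal_diophantine_graph_def diophantine_graph_def simple_graph_def)
  ultimately show "u \<noteq> w \<and> gcd (f u) (f w) dvd card V"
    using lab by (auto simp: nsets_def diophantine_labelling_def)
next
  assume r: "u \<noteq> w \<and> gcd (f u) (f w) dvd card V"
  show "{u, w} \<in> E"
  proof (rule ccontr)
    assume "{u, w} \<notin> E"
    moreover have edge: "{u, w} \<in> [V]\<^bsup>2\<^esup>"
      using r assms(3,4) by (auto simp: nsets_def)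
    ultimately have "\<not> diophantine_graph V (insert {u, w} E)"
      using max by (simp add: maximal_diophantine_graph_def)
    moreover have "simple_graph V (insert {u, w} E)"
      using max edge
      by (simp add: maximal_diophantine_graph_def diophantine_graph_def simple_graph_def)
    \<comment> \<open>The new edge is an unordered pair, so its endpoints may be read in either
      order; symmetry of the gcd covers both readings.\<close>
    moreover have "diophantine_labelling V (insert {u, w} E) f"
      using lab r by (auto simp: diophantine_labelling_def doubleton_eq_iff gcd.commute)
    ultimately show False
      by (auto simp: diophantine_graph_def)
  qed
qed

text \<open>The gcd divides \<open>p ^ t\<close>, so it is some \<open>p ^ i\<close>. This fails to
  divide \<open>n\<close> exactly when \<open>i\<close> reaches \<open>vsucc p n\<close>, that is,
  when \<open>p ^ vsucc p n\<close> divides the gcd and hence both of its arguments.\<close>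

lemma gcd_prime_power_dvd_iff:
  fixes p m n t :: nat
  assumes p: "prime p" and "n > 0"
  shows "gcd (p ^ t) m dvd n \<longleftrightarrow> \<not> (vsucc p n \<le> t \<and> p ^ vsucc p n dvd m)"
proof -
  have iff: "p ^ j dvd n \<longleftrightarrow> j < vsucc p n" for j
    using power_dvd_iff_le_multiplicity[of n p j] prime_gt_1_nat[OF p] \<open>n > 0\<close>
    by (auto simp: vsucc_def less_Suc_eq_le)
  obtain i where i: "i \<le> t" "gcd (p ^ t) m = p ^ i"
    using divides_primepow_nat[OF p, of "gcd (p ^ t) m" t] by auto
  have "vsucc p n \<le> i \<longleftrightarrow> p ^ vsucc p n dvd gcd (p ^ t) m"
    using p by (simp add: i(2) prime_gt_1_nat dvd_power_iff_le prime_ge_2_nat)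
  also have "\<dots> \<longleftrightarrow> vsucc p n \<le> t \<and> p ^ vsucc p n dvd m"
    using p by (simp add: dvd_power_iff_le prime_ge_2_nat)
  finally show ?thesis
    using iff[of i] i(2) by auto
qed

lemma card_multiples_upto:
  fixes d n :: nat
  assumes "d > 0"
  shows "card {m \<in> {1..n}. d dvd m} = n div d"
proof -
  have "{m \<in> {1..n}. d dvd m} = (\<lambda>i. d * i) ` {1..n div d}"
  proof (intro equalityI subsetI)
    fix m assume "m \<in> {m \<in> {1..n}. d dvd m}"
    then obtain i where "m = d * i" "1 \<le> m" "m \<le> n" by (auto elim: dvdE)
    moreover from this have "i \<le> n div d" "1 \<le> i"
      using assms by (auto simp: less_eq_div_iff_mult_less_eq mult.commute Suc_le_eq)
    ultimately show "m \<in> (\<lambda>i. d * i) ` {1..n div d}" by auto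
  qed (use assms in \<open>auto simp: less_eq_div_iff_mult_less_eq mult.commute Suc_le_eq\<close>)
  then show ?thesis
    using assms by (simp add: card_image inj_on_def)
qed

text \<open>Applied to \<open>u\<close> and to \<open>v\<close>, this settles the two exponent
  conditions of the final equivalence outright, so that only the comparison of the two quotients
  remains.\<close>

lemma vertex_degree_prime_power_label:
  assumes max: "maximal_diophantine_graph V E" and lab: "diophantine_labelling V E f"
    and "u \<in> V" and p: "prime p" and fu: "f u = p ^ t"
    and deg: "vertex_degree V E u < card V - 1"
  shows "vsucc p (card V) \<le> t"
    and "vertex_degree V E u = card V - card V div p ^ vsucc p (card V)"
proof -
  let ?n = "card V" and ?s = "vsucc p (card V)"
  have fin: "finite V" and "?n > 0"
    using max \<open>u \<in> V\<close> by (auto simp: maximal_diophantine_graph_def diophantine_graph_def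
        simple_graph_def card_gt_0_iff)
  have bij: "bij_betw f V {1..?n}"
    using lab by (simp add: diophantine_labelling_def)
  have adj: "{u, w} \<in> E \<longleftrightarrow> u \<noteq> w \<and> \<not> (?s \<le> t \<and> p ^ ?s dvd f w)" if "w \<in> V" for w
    using maximal_diophantine_adjacent_iff[OF max lab \<open>u \<in> V\<close> that]
      gcd_prime_power_dvd_iff[OF p \<open>?n > 0\<close>] fu by simp
  show le: "?s \<le> t"
  proof (rule ccontr)
    assume "\<not> ?s \<le> t"
    \<comment> \<open>With too small an exponent no label can obstruct adjacency, so
      \<open>u\<close> would have the full degree \<open>card V - 1\<close>, against
      \<open>deg\<close>.\<close>
    then have "{w \<in> V. {u, w} \<in> E} = V - {u}" using adj by auto
    then show False
      using deg \<open>u \<in> V\<close> fin by (simp add: vertex_degree_def)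
  qed
  \<comment> \<open>The label of \<open>u\<close> is itself one of the multiples, so removing the
    multiples already removes \<open>u\<close>, and the condition \<open>u \<noteq> w\<close> costs
    no extra vertex.\<close>
  have "p ^ ?s dvd f u" using le fu by (simp add: le_imp_power_dvd)
  then have "{w \<in> V. {u, w} \<in> E} = V - {w \<in> V. p ^ ?s dvd f w}"
    using adj le by auto
  moreover have "card {w \<in> V. p ^ ?s dvd f w} = card {m \<in> {1..?n}. p ^ ?s dvd m}"
  proof (rule bij_betw_same_card)
    \<comment> \<open>Since \<open>f\<close> is onto \<open>{1..card V}\<close>, every multiple in
      that range is the label of some vertex.\<close>
    show "bij_betw f {w \<in> V. p ^ ?s dvd f w} {m \<in> {1..?n}. p ^ ?s dvd m}"
      using bij by (auto simp: bij_betw_def inj_on_def)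
  qed
  ultimately show "vertex_degree V E u = ?n - ?n div p ^ ?s"
    using fin p card_multiples_upto[of "p ^ ?s" ?n]
    by (simp add: vertex_degree_def card_Diff_subset prime_gt_0_nat)
qed

theorem theorem4p4:
  fixes n :: nat and V :: "'a set" and E :: "'a set set" and f :: "'a \<Rightarrow> nat"
    and u v :: 'a and p q t k :: nat
  assumes "n > 0"
    and "maximal_diophantine_graph V E" and "card V = n"
    and "diophantine_labelling V E f"
    and "u \<in> V" and "v \<in> V"
    and "vertex_degree V E u < n - 1" and "vertex_degree V E v < n - 1"
    and "prime p" and "prime q" and "t > 0" and "k > 0"
    and "f u = p ^ t" and "f v = q ^ k"
  shows "vertex_degree V E u = vertex_degree V E v \<longleftrightarrow>
    vsucc p n \<le> t \<and> vsucc q n \<le> k \<and>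
    \<lfloor>real n / real (p ^ vsucc p n)\<rfloor> = \<lfloor>real n / real (q ^ vsucc q n)\<rfloor>"
proof -
  have "vsucc p n \<le> t" "vertex_degree V E u = n - n div p ^ vsucc p n"
    using vertex_degree_prime_power_label[OF assms(2,4,5,9,13)] assms(3,7) by auto
  moreover have "vsucc q n \<le> k" "vertex_degree V E v = n - n div q ^ vsucc q n"
    using vertex_degree_prime_power_label[OF assms(2,4,6,10,14)] assms(3,8) by auto
  \<comment> \<open>Subtraction on naturals truncates at 0; these bounds make
    \<open>n - a = n - b\<close> imply \<open>a = b\<close>. The real floors of the statement are
    then natural number quotients.\<close>
  moreover have "n div p ^ vsucc p n \<le> n" "n div q ^ vsucc q n \<le> n"
    by (rule div_le_dividend)+
  ultimately show ?thesis
    by (simp only: floor_divide_of_nat_eq of_nat_eq_iff) (metis diff_diff_cancel)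
qed

end
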